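(* Let $n,t,d\ge 1$ be integers with $n>3t$. For $n$ clients with vectors in $\mathbb{R}^d$, up to $t$ of which are Byzantine, satisfying weak validity is not a sufficient condition for an aggregation algorithm to achieve a bounded approximation ratio of $\mathrm{Cent}^\star$: there exists an aggregation algorithm that satisfies weak validity but, for every $\alpha<\infty$, does not compute an $\alpha$-approximation of the centroid.
   Context: Model. There are $n$ clients, up to $t<n/3$ of which are Byzantine, and one trusted server. The server receives a family of $m$ vectors $(v_i)_{i\in M}$ in $\mathbb{R}^d$ (Euclidean norm and distance $\mathrm{dist}$), where $M\subseteq\{1,\dots,n\}$, $|M|=m$, $n-t\le m\le n$. An unknown set $N\subseteq M$ with $|N|\ge n-t$ is the set of non-faulty clients; the vectors of the clients in $M\setminus N$ are Byzantine and arbitrary. An aggregation algorithm $\mathcal{A}$ is a deterministic function of the received family only (it does not know $N$); its output is a vector in $\mathbb{R}^d$. A received family together with an admissible set $N$ is called a configuration. True centroid: $\mathrm{Cent}^\star=\frac1{|N|}\sum_{i\in N}v_i$. Candidate centroids: $S_{\mathrm{Cent}}$ is the set of all averages $\frac{1}{n-t}\sum_{i\in I}v_i$ with $I\subseteq M$, $|I|=n-t$. Let $\mathrm{Rad_{cov}}$ be the radius of the smallest closed Euclidean ball containing $S_{\mathrm{Cent}}$. Approximation: $\mathcal{A}$ computes an $\alpha$-approximation of the centroid if, in every configuration, its output $O$ satisfies $\mathrm{dist}(O,\mathrm{Cent}^\star)\le\alpha\cdot\mathrm{Rad_{cov}}$. Weak validity: whenever all $n$ clients are non-faulty ($N=M=\{1,\dots,n\}$)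 and all input vectors are equal to a single vector $v$, the output of $\mathcal{A}$ is $v$. *)

theory Defs
  imports "HOL-Analysis.Analysis"
begin

text \<open>
  A received family \<open>(v\<^sub>i)\<^sub>i\<^sub>\<in>\<^sub>M\<close> is a partial map \<open>V\<close> on client identifiers with \<open>dom V = M\<close>, so
  an aggregation algorithm, being a function of \<open>V\<close> alone, sees \<open>M\<close> and the vectors but not \<open>N\<close>.
  The ambient space is \<open>real ^ 'd\<close>, with \<open>d = CARD('d) \<ge> 1\<close>.
\<close>

type_synonym 'd family = "nat \<rightharpoonup> real ^ 'd"
type_synonym 'd aggregation = "'d family \<Rightarrow> real ^ 'd"

definition configuration :: "nat \<Rightarrow> nat \<Rightarrow> 'd::finite family \<Rightarrow> nat set \<Rightarrow> bool" where
  "configuration n t V N \<longleftrightarrow>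
     dom V \<subseteq> {1..n} \<and> n - t \<le> card (dom V) \<and> N \<subseteq> dom V \<and> n - t \<le> card N"

definition true_centroid :: "'d::finite family \<Rightarrow> nat set \<Rightarrow> real ^ 'd" where
  "true_centroid V N = (1 / real (card N)) *\<^sub>R (\<Sum>i\<in>N. the (V i))"

definition candidate_centroids :: "nat \<Rightarrow> nat \<Rightarrow> 'd::finite family \<Rightarrow> (real ^ 'd) set" where
  "candidate_centroids n t V =
     {(1 / real (n - t)) *\<^sub>R (\<Sum>i\<in>I. the (V i)) | I. I \<subseteq> dom V \<and> card I = n - t}"

definition covering_radius :: "'a::metric_space set \<Rightarrow> real" where
  "covering_radius S = (LEAST r. 0 \<le> r \<and> (\<exists>c. S \<subseteq> cball c r))"

text \<open>
  \<^const>\<open>Least\<close> on the reals is only meaningful if a minimum exists; the next two lemmas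
  confirm this for the sets it is applied to.
\<close>

lemma smallest_cball:
  fixes S :: "'a::heine_borel set"
  assumes "bounded S" "S \<noteq> {}"
  shows "0 \<le> covering_radius S"
    and "\<exists>c. S \<subseteq> cball c (covering_radius S)"
    and "\<And>c r. S \<subseteq> cball c r \<Longrightarrow> covering_radius S \<le> r"
proof -
  define R where "R = {r. 0 \<le> r \<and> (\<exists>c. S \<subseteq> cball c r)}"
  obtain x where x: "x \<in> S" using assms(2) by blast
  obtain c0 e0 where "S \<subseteq> cball c0 e0" using assms(1) by (meson bounded_subset_cball)
  moreover have "0 \<le> e0" using calculation x by (metis in_mono mem_cball zero_le_dist order_trans)
  ultimately have ne: "R \<noteq> {}" unfolding R_def by blast
  have bdd: "bdd_below R" by (rule bdd_belowI[of _ 0]) (simp add: R_def)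
  have pos: "0 \<le> Inf R" using ne by (rule cInf_greatest) (simp add: R_def)
  define F where "F k = (\<Inter>x\<in>S. cball x (Inf R + 1 / real (Suc k)))" for k
  have "\<Inter>(range F) \<noteq> {}"
  proof (rule compact_nest)
    fix k
    have "closed (F k)" unfolding F_def by blast
    moreover have "bounded (F k)"
      using x unfolding F_def by (intro bounded_subset[OF bounded_cball[of x]] INT_lower) auto
    ultimately show "compact (F k)" by (simp add: compact_eq_bounded_closed)
    have "Inf R < Inf R + 1 / real (Suc k)" by simp
    then obtain r where r: "r \<in> R" "r < Inf R + 1 / real (Suc k)"
      using cInf_lessD[OF ne] by blast
    then obtain c where "S \<subseteq> cball c r" unfolding R_def by blast
    then have "c \<in> F k" using r(2) unfolding F_def by (force simp: dist_commute)
    then show "F k \<noteq> {}" by blast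
  next
    fix m k :: nat assume "m \<le> k"
    then have "1 / real (Suc k) \<le> 1 / real (Suc m)" by (simp add: frac_le)
    then show "F k \<subseteq> F m" unfolding F_def by (intro INT_anti_mono) auto
  qed
  then obtain c where c: "\<And>k. c \<in> F k" by blast
  have "dist c y \<le> Inf R" if "y \<in> S" for y
  proof (rule field_le_epsilon)
    fix e :: real assume "e > 0"
    then obtain k where "1 / real (Suc k) < e" by (metis nat_approx_posE)
    moreover have "dist y c \<le> Inf R + 1 / real (Suc k)" using c[of k] that by (simp add: F_def)
    ultimately show "dist c y \<le> Inf R + e" by (simp add: dist_commute)
  qed
  then have cov: "S \<subseteq> cball c (Inf R)" by auto
  have low: "Inf R \<le> r" if "0 \<le> r \<and> (\<exists>c. S \<subseteq> cball c r)" for r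
    using that bdd by (intro cInf_lower) (auto simp: R_def)
  have eq: "covering_radius S = Inf R"
    unfolding covering_radius_def using pos cov low by (intro Least_equality) auto
  show "0 \<le> covering_radius S" "\<exists>c. S \<subseteq> cball c (covering_radius S)"
    using eq pos cov by auto
  show "covering_radius S \<le> r" if "S \<subseteq> cball c r" for c r
  proof -
    have "0 \<le> r" using that x by (metis in_mono mem_cball zero_le_dist order_trans)
    then show ?thesis using low that eq by auto
  qed
qed

lemma candidate_centroids_bounded_nonempty:
  assumes "configuration n t V N"
  shows "bounded (candidate_centroids n t V)" "candidate_centroids n t V \<noteq> {}"
proof -
  have fin: "finite (dom V)" using assms unfolding configuration_def by (meson finite_atLeastAtMost finite_subset)
  have eq: "candidate_centroids n t V =
    (\<lambda>I. (1 / real (n - t)) *\<^sub>R (\<Sum>i\<in>I. the (V i))) ` {I. I \<subseteq> dom V \<and> card I = n - t}"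
    unfolding candidate_centroids_def by blast
  show "bounded (candidate_centroids n t V)"
    unfolding eq using fin by (intro finite_imp_bounded finite_imageI) auto
  obtain I where "I \<subseteq> dom V" "card I = n - t"
    using assms unfolding configuration_def by (meson obtain_subset_with_card_n)
  then show "candidate_centroids n t V \<noteq> {}" unfolding eq by blast
qed

definition approximates_centroid :: "nat \<Rightarrow> nat \<Rightarrow> 'd::finite aggregation \<Rightarrow> real \<Rightarrow> bool" where
  "approximates_centroid n t A \<alpha> \<longleftrightarrow>
     (\<forall>V N. configuration n t V N \<longrightarrow>
        dist (A V) (true_centroid V N) \<le> \<alpha> * covering_radius (candidate_centroids n t V))"

definition weak_validity :: "nat \<Rightarrow> nat \<Rightarrow> 'd::finite aggregation \<Rightarrow> bool" where
  "weak_validity n t A \<longleftrightarrow>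
     (\<forall>V N v. configuration n t V N \<and> N = {1..n} \<and> dom V = {1..n} \<and> (\<forall>i\<in>{1..n}. V i = Some v)
        \<longrightarrow> A V = v)"

end

(* An algorithm may behave arbitrarily as soon as one vector is missing.  If n - 1 equal vectors
   arrive, all candidate centroids coincide with the true one, so the covering radius is 0 and any
   error in the output violates every approximation ratio. *)
theory Submission
  imports Defs
begin

lemma covering_radius_singleton:
  fixes x :: "'a::heine_borel"
  shows "covering_radius {x} = 0"
proof (rule antisym)
  show "covering_radius {x} \<le> 0"
    by (rule smallest_cball(3)[of _ x]) auto
  show "0 \<le> covering_radius {x}"
    by (rule smallest_cball(1)) auto
qed

theorem lemma3p1:
  fixes n t :: nat
  assumes "n \<ge> 1" and "t \<ge> 1" and "n > 3 * t"
  shows "\<exists>A :: 'd::finite aggregation.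
           weak_validity n t A \<and> (\<forall>\<alpha>::real. \<not> approximates_centroid n t A \<alpha>)"
proof -
  \<comment> \<open>On unanimous full input every entry is the common vector, so reading client 1
    gives weak validity. The fallback \<open>1\<close> is the all-ones vector, chosen only for being
    nonzero.\<close>
  define A :: "'d aggregation" where "A V = (if dom V = {1..n} then the (V 1) else 1)" for V
  define V :: "'d family" where "V i = (if i \<in> {1..n - 1} then Some 0 else None)" for i
  have dom: "dom V = {1..n - 1}"
    by (auto simp: V_def dom_def)
  \<comment> \<open>One silent client is tolerated because \<open>t \<ge> 1\<close> gives n - t
    \<le> n - 1; all senders count as non-faulty.\<close>
  have conf: "configuration n t V (dom V)"
    using assms by (auto simp: configuration_def dom)
  have zero: "(\<Sum>i\<in>I. the (V i)) = 0" if "I \<subseteq> dom V" for I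
    using that by (intro sum.neutral) (auto simp: V_def dom)
  have "candidate_centroids n t V \<subseteq> {0}"
    using zero by (auto simp: candidate_centroids_def)
  \<comment> \<open>Nonemptiness turns the inclusion into equality, so that the radius is that of a
    point.\<close>
  then have "candidate_centroids n t V = {0}"
    using candidate_centroids_bounded_nonempty(2)[OF conf] by blast
  then have radius: "covering_radius (candidate_centroids n t V) = 0"
    by (simp add: covering_radius_singleton)
  have centroid: "true_centroid V (dom V) = 0"
    by (simp add: true_centroid_def zero)
  have "n \<in> {1..n}" "n \<notin> {1..n - 1}"
    using assms(1) by auto
  then have "dom V \<noteq> {1..n}"
    unfolding dom by blast
  then have "A V = 1"
    by (simp add: A_def)
  \<comment> \<open>The bound would read dist 1 0 \<le> \<alpha> * 0 = 0, whatever \<alpha>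
    is.\<close>
  then have "\<not> approximates_centroid n t A \<alpha>" for \<alpha>
    using conf radius centroid unfolding approximates_centroid_def
    by (metis dist_le_zero_iff mult_zero_right zero_neq_one)
  moreover have "weak_validity n t A"
    using assms(1) by (auto simp: weak_validity_def A_def)
  ultimately show ?thesis
    by blast
qed

end
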